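(* Let $\ell$ denote the one-dimensional Lebesgue measure. Let $h : (0,1) \to (0,1)$ be a Borel measurable map preserving the Lebesgue measure $\ell$ on $(0,1)$. Let $j : [0,1) \to \mathbb{R}$ be a Borel measurable map such that $\ell(\{x \in [0,1) : j(x) = c\}) < 1$ for every $c \in \mathbb{R}$. Then there do not exist Borel measurable functions $f, g : (0,1) \to (0,1)$ such that $$f(x) + g(y) = j\left(\pi(h(x) + y)\right) \quad \text{for all } x, y \in (0,1),$$ where $\pi(z) \in [0,1)$ denotes the fractional part of $z$.
   Context: A Borel measurable map $h:(0,1)\to(0,1)$ preserves the Lebesgue measure $\ell$ if $\ell(h^{-1}(A)) = \ell(A)$ for every Borel set $A \subseteq (0,1)$. The fractional part of a real number $z$ is $\pi(z) = z - \lfloor z \rfloor$. *)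

theory Defs
  imports "HOL-Analysis.Analysis"
begin

(* Maps on (0,1), resp. [0,1), are total functions on the reals considered only on that set:
   measurability refers to the trace of the Borel sigma-algebra, and measurability into
   borel_unit includes that (0,1) is mapped into (0,1).  Accordingly, the preimage of a set
   is cut down to (0,1). *)

abbreviation borel_unit :: "real measure" where
  "borel_unit \<equiv> restrict_space borel {0<..<1}"

definition preserves_lebesgue :: "(real \<Rightarrow> real) \<Rightarrow> bool" where
  "preserves_lebesgue h \<longleftrightarrow>
     (\<forall>A. A \<in> sets borel \<and> A \<subseteq> {0<..<1} \<longrightarrow>
        emeasure lborel (h -` A \<inter> {0<..<1}) = emeasure lborel A)"

end

(* Integrating the equation over y and using that rotations preserve Lebesgue measure shows
   f x + (integral of g) = (integral of j) for every x, so f is a constant.  For a fixed y the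
   value j (frac (h x + y)) then does not depend on x; since h preserves Lebesgue measure, j equals
   this value almost everywhere. *)

theory Submission
  imports Defs
begin

text \<open>The rotation is a translation by \<open>a\<close> on \<open>y < 1 - a\<close>, with
  image the open interval from \<open>a\<close> to 1, and by \<open>a - 1\<close> on the rest, with
  image \<open>{0..<a}\<close>. Translations preserve \<open>lborel\<close>, and the two images miss
  only the null point \<open>a\<close>, which would come from \<open>y = 0\<close>.\<close>

lemma nn_integral_lborel_rotate:
  fixes F :: "real \<Rightarrow> ennreal"
  assumes F [measurable]: "F \<in> borel_measurable borel" and a: "0 < a" "a < 1"
  shows "(\<integral>\<^sup>+y. F (frac (a + y)) * indicator {0<..<1} y \<partial>lborel) =
         (\<integral>\<^sup>+u. F u * indicator {0..<1} u \<partial>lborel)"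
proof -
  define G where "G u = F u * indicator {a<..<1} u" for u
  define H where "H u = F u * indicator {0..<a} u" for u
  have [measurable]: "G \<in> borel_measurable borel" "H \<in> borel_measurable borel"
    unfolding G_def H_def by measurable
  have frac_eq: "frac (a + y) = (if a + y < 1 then a + y else a + y - 1)"
    if "y \<in> {0<..<1}" for y
    using that a by (auto simp: frac_unique_iff Ints_def)
  have "F (frac (a + y)) * indicator {0<..<1} y = G (a + y) + H (a - 1 + y)" for y
    using a by (cases "y \<in> {0<..<1}")
      (auto simp: frac_eq G_def H_def indicator_def algebra_simps)
  then have "(\<integral>\<^sup>+y. F (frac (a + y)) * indicator {0<..<1} y \<partial>lborel) =
      (\<integral>\<^sup>+y. G (a + y) \<partial>lborel) + (\<integral>\<^sup>+y. H (a - 1 + y) \<partial>lborel)"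
    by (simp add: nn_integral_add)
  also have "\<dots> = (\<integral>\<^sup>+u. G u \<partial>lborel) + (\<integral>\<^sup>+u. H u \<partial>lborel)"
    using nn_integral_real_affine[of G 1 a] nn_integral_real_affine[of H 1 "a - 1"] by simp
  also have "\<dots> = (\<integral>\<^sup>+u. G u + H u \<partial>lborel)"
    by (simp add: nn_integral_add)
  also have "\<dots> = (\<integral>\<^sup>+u. F u * indicator {0..<1} u \<partial>lborel)"
    using AE_lborel_singleton[of a] a
    by (intro nn_integral_cong_AE) (auto simp: G_def H_def indicator_def elim!: eventually_mono)
  finally show ?thesis .
qed

theorem theorem1p2:
  fixes h j :: "real \<Rightarrow> real"
  assumes "h \<in> borel_unit \<rightarrow>\<^sub>M borel_unit"
    and "preserves_lebesgue h"
    and "j \<in> restrict_space borel {0..<1} \<rightarrow>\<^sub>M borel"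
    and "\<And>c. emeasure lborel {x \<in> {0..<1}. j x = c} < 1"
  shows "\<not> (\<exists>f g :: real \<Rightarrow> real.
           f \<in> borel_unit \<rightarrow>\<^sub>M borel_unit \<and>
           g \<in> borel_unit \<rightarrow>\<^sub>M borel_unit \<and>
           (\<forall>x \<in> {0<..<1}. \<forall>y \<in> {0<..<1}. f x + g y = j (frac (h x + y))))"
proof
  assume "\<exists>f g :: real \<Rightarrow> real.
           f \<in> borel_unit \<rightarrow>\<^sub>M borel_unit \<and>
           g \<in> borel_unit \<rightarrow>\<^sub>M borel_unit \<and>
           (\<forall>x \<in> {0<..<1}. \<forall>y \<in> {0<..<1}. f x + g y = j (frac (h x + y)))"
  then obtain f g :: "real \<Rightarrow> real"
    where f: "f \<in> borel_unit \<rightarrow>\<^sub>M borel_unit" and g: "g \<in> borel_unit \<rightarrow>\<^sub>M borel_unit"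
      and eq: "\<And>x y. x \<in> {0<..<1} \<Longrightarrow> y \<in> {0<..<1} \<Longrightarrow> f x + g y = j (frac (h x + y))"
    by blast
  have unit: "k x \<in> {0<..<1}" if "k \<in> borel_unit \<rightarrow>\<^sub>M borel_unit" "x \<in> {0<..<1}"
    for k :: "real \<Rightarrow> real" and x
    using measurable_space[OF that(1), of x] that(2) by (simp add: space_restrict_space)
  \<comment> \<open>Extension by zero gives a Borel function on the whole line, as the rotation
    lemma requires. The value 0 is never seen, since \<open>frac\<close> takes values in
    \<open>{0..<1}\<close>.\<close>
  define J where "J u = (if u \<in> {0..<1} then j u else 0)" for u
  have J [measurable]: "J \<in> borel_measurable borel"
    using assms(3) unfolding J_def by (subst (asm) measurable_restrict_space_iff[where c = 0]) auto
  have J_frac: "J (frac z) = j (frac z)" for z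
    by (simp add: J_def frac_lt_1)
  define I where "I = (\<integral>\<^sup>+y. ennreal (g y) * indicator {0<..<1} y \<partial>lborel)"
  have g_real: "g \<in> borel_measurable borel_unit"
    using g by (simp add: measurable_restrict_space2_iff)
  have g_meas: "(\<lambda>y. ennreal (g y) * indicator {0<..<1} y) \<in> borel_measurable lborel"
  proof -
    have "(\<lambda>y. if y \<in> {0<..<1} then g y else 0) \<in> borel_measurable borel"
      using g_real by (subst (asm) measurable_restrict_space_iff[where c = 0]) auto
    then have "(\<lambda>y. ennreal (if y \<in> {0<..<1} then g y else 0)) \<in> borel_measurable lborel"
      by measurable
    also have "(\<lambda>y. ennreal (if y \<in> {0<..<1} then g y else 0)) =
        (\<lambda>y. ennreal (g y) * indicator {0<..<1} y)"
      by (auto simp: indicator_def)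
    finally show ?thesis .
  qed
  \<comment> \<open>Cancelling \<open>I\<close> from a sum in \<open>ennreal\<close> requires it to
    be finite; this follows from \<open>g < 1\<close>.\<close>
  have "I \<le> (\<integral>\<^sup>+y. 1 * indicator {0<..<1::real} y \<partial>lborel)"
    unfolding I_def using unit[OF g]
    by (intro nn_integral_mono) (auto simp: indicator_def less_imp_le)
  also have "\<dots> = 1"
    by (subst nn_integral_cmult_indicator) auto
  finally have I_fin: "I \<noteq> top"
    by (auto simp: top_unique)
  \<comment> \<open>The right-hand side is free of \<open>x\<close>, because the rotation by
    \<open>h x\<close> leaves the integral unchanged. Although \<open>ennreal\<close> cuts off
    negative values, nothing is lost: the values of \<open>J\<close> that occur after the rotation
    are sums \<open>f x + g y\<close> of positive numbers.\<close>
  have f_int: "ennreal (f x) + I = (\<integral>\<^sup>+u. ennreal (J u) * indicator {0..<1} u \<partial>lborel)"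
    if x: "x \<in> {0<..<1}" for x
  proof -
    have "(\<integral>\<^sup>+u. ennreal (J u) * indicator {0..<1} u \<partial>lborel) =
        (\<integral>\<^sup>+y. ennreal (J (frac (h x + y))) * indicator {0<..<1} y \<partial>lborel)"
      using unit[OF assms(1) x] by (intro nn_integral_lborel_rotate[symmetric]) auto
    also have "\<dots> = (\<integral>\<^sup>+y. ennreal (f x) * indicator {0<..<1} y +
        ennreal (g y) * indicator {0<..<1} y \<partial>lborel)"
      using unit[OF f x] unit[OF g]
      by (intro nn_integral_cong)
        (auto simp: J_frac eq[OF x, symmetric] indicator_def less_imp_le)
    also have "\<dots> = ennreal (f x) + I"
      using g_meas by (simp add: nn_integral_add I_def nn_integral_cmult_indicator)
    finally show ?thesis ..
  qed
  have f_const: "f x = f (1/2)" if x: "x \<in> {0<..<1}" for x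
  proof -
    have "ennreal (f x) + I = ennreal (f (1/2)) + I"
      using f_int[OF x] f_int[of "1/2"] by simp
    then have "ennreal (f x) = ennreal (f (1/2))"
      using I_fin by (metis add.commute ennreal_add_left_cancel infinity_ennreal_def)
    then show ?thesis
      using unit[OF f x] unit[OF f, of "1/2"] by simp
  qed
  \<comment> \<open>Fix \<open>y = 1/2\<close>; any point of the interval would do. As
    \<open>f\<close> is constant, \<open>j (frac (h x + 1/2)) = c\<close> for every \<open>x\<close>
    in the interval. So \<open>h\<close> takes all its values in \<open>A\<close>, the level set
    \<open>C\<close> rotated back by 1/2.\<close>
  define c where "c = f (1/2) + g (1/2)"
  define C where "C = {u \<in> {0..<1}. j u = c}"
  define A where "A = {u \<in> {0<..<1}. frac (1/2 + u) \<in> C}"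
  have "C = {u \<in> {0..<1}. J u = c}"
    by (auto simp: C_def J_def)
  then have [measurable]: "C \<in> sets borel"
    by simp
  have [measurable]: "A \<in> sets borel"
    unfolding A_def frac_def by measurable
  have "A \<subseteq> {0<..<1}"
    by (auto simp: A_def)
  have ind: "indicator C (frac (1/2 + u)) * indicator {0<..<1} u = (indicator A u :: ennreal)"
    for u
    by (auto simp: indicator_def A_def)
  have "h -` A \<inter> {0<..<1} = {0<..<1}"
  proof -
    have "h x \<in> A" if x: "x \<in> {0<..<1}" for x
      using unit[OF assms(1) x] eq[OF x, of "1/2"] f_const[OF x]
      by (simp add: A_def C_def c_def frac_lt_1 add.commute)
    then show ?thesis
      by blast
  qed
  moreover have "emeasure lborel (h -` A \<inter> {0<..<1}) = emeasure lborel A"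
    using assms(2) \<open>A \<in> sets borel\<close> \<open>A \<subseteq> {0<..<1}\<close>
    unfolding preserves_lebesgue_def by blast
  ultimately have "1 = emeasure lborel A"
    by simp
  \<comment> \<open>The set \<open>A\<close> has full measure because \<open>h\<close> preserves
    measure; rotating by 1/2 carries this over to \<open>C\<close>, whose measure is less than 1 by
    hypothesis.\<close>
  also have "\<dots> = (\<integral>\<^sup>+u. indicator C (frac (1/2 + u)) * indicator {0<..<1} u \<partial>lborel)"
    by (simp add: ind)
  also have "\<dots> = (\<integral>\<^sup>+u. indicator C u * indicator {0..<1} u \<partial>lborel)"
    by (intro nn_integral_lborel_rotate) auto
  also have "\<dots> = (\<integral>\<^sup>+u. indicator C u \<partial>lborel)"
    by (intro nn_integral_cong) (auto simp: indicator_def C_def)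
  also have "\<dots> = emeasure lborel C"
    by simp
  finally show False
    using assms(4)[of c] by (simp add: C_def)
qed

end
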